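(* Let $0 \leq a < b$ be real numbers. There exist two absolutely continuous Borel probability measures $P_x, P_y$ on $\mathbb{R}$ with support contained in $[a, b]$ that are not comparable with respect to the stochastic tail order, i.e. neither $P_x \preccurlyeq_{\text{tail}} P_y$ nor $P_y \preccurlyeq_{\text{tail}} P_x$ holds.
   Context: Absolute continuity is with respect to Lebesgue measure. For Borel probability measures $P$ on $\mathbb{R}$ having moments of all orders, let $m_k(P) = \int x^k \, dP(x)$, $k \in \mathbb{N}_0$. The stochastic tail order: $P \preccurlyeq_{\text{tail}} Q$ iff $P = Q$, or ($P, Q$ have moments of all orders and $m_k(P) \leq m_k(Q)$ for all but finitely many $k \in \mathbb{N}_0$). *)

theory Defs
  imports "HOL-Probability.Probability"
begin

definition moment :: "real measure \<Rightarrow> nat \<Rightarrow> real" where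
  "moment P k = (LINT x|P. x ^ k)"

text \<open>Existence of moments is required separately, because the Bochner integral of a
  non-integrable function is 0.\<close>

definition has_all_moments :: "real measure \<Rightarrow> bool" where
  "has_all_moments P \<longleftrightarrow> (\<forall>k::nat. integrable P (\<lambda>x. x ^ k))"

definition tail_le :: "real measure \<Rightarrow> real measure \<Rightarrow> bool" (infix "\<preceq>tail" 50) where
  "P \<preceq>tail Q \<longleftrightarrow>
     P = Q \<or>
     (has_all_moments P \<and> has_all_moments Q \<and> (\<forall>\<^sub>\<infinity>k. moment P k \<le> moment Q k))"

definition measure_support :: "'a::topological_space measure \<Rightarrow> 'a set" where
  "measure_support P = {x. \<forall>U. open U \<and> x \<in> U \<longrightarrow> emeasure P U > 0}"

end

(* Let h be a function on [a, b] with values in [-1, 1] and mean zero; the densities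
   (1 + h) / (b - a) and (1 - h) / (b - a) have moments of order k that differ by a positive
   multiple of the integral of x^k h(x).  We let h alternate between 1 and -1 on the intervals
   [t n, t (n + 1)] with t n = b (1/4)^(1/8^n), which accumulate at b.  For k + 1 = 8^n the interval
   [t n, t (n + 1)] carries more than half of the integral of x^k over [0, b], so that the sign of h
   on it determines the sign of the difference, and this sign changes infinitely often.  A constant
   value of h on the left half of [a, b] makes the mean zero and does not affect this argument. *)

theory Submission
  imports Defs
begin

section \<open>Perturbations of the uniform distribution on an interval\<close>

text \<open>\<open>ennreal\<close> truncates negative values to 0, so the formulas below assume
  \<open>\<bar>h x\<bar> \<le> 1\<close>, which keeps the density nonnegative.\<close>

definition tilted_uniform :: "real \<Rightarrow> real \<Rightarrow> (real \<Rightarrow> real) \<Rightarrow> real measure" where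
  "tilted_uniform a b h =
     density lborel (\<lambda>x. ennreal (indicator {a..b} x * (1 + h x) / (b - a)))"

lemma integrable_indicator_mult_bounded:
  fixes h :: "real \<Rightarrow> real"
  assumes "h \<in> borel_measurable borel" "\<And>x. \<bar>h x\<bar> \<le> C"
  shows "integrable lborel (\<lambda>x. indicator {a..b} x * (x ^ k * h x))"
proof -
  have "integrable lborel (\<lambda>x. C * (\<bar>x\<bar> ^ k * indicator {a..b} x))"
    by (intro integrable_mult_right borel_integrable_atLeastAtMost) auto
  then show ?thesis
  proof (rule Bochner_Integration.integrable_bound)
    show "(\<lambda>x. indicator {a..b} x * (x ^ k * h x)) \<in> borel_measurable lborel"
      using assms(1) by measurable
    show "AE x in lborel. norm (indicator {a..b} x * (x ^ k * h x))
      \<le> norm (C * (\<bar>x\<bar> ^ k * indicator {a..b} x))"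
    proof (intro AE_I2)
      fix x
      have "\<bar>x\<bar> ^ k * \<bar>h x\<bar> \<le> \<bar>x\<bar> ^ k * \<bar>C\<bar>"
        using assms(2)[of x] by (intro mult_left_mono) auto
      then show "norm (indicator {a..b} x * (x ^ k * h x))
          \<le> norm (C * (\<bar>x\<bar> ^ k * indicator {a..b} x))"
        by (simp add: indicator_def abs_mult power_abs mult.commute)
    qed
  qed
qed

lemma integrable_tilted_density:
  fixes h :: "real \<Rightarrow> real"
  assumes "h \<in> borel_measurable borel" "\<And>x. \<bar>h x\<bar> \<le> 1"
  shows "integrable lborel (\<lambda>x. indicator {a..b} x * (1 + h x) / (b - a) * x ^ k)"
proof -
  have "\<bar>1 + h x\<bar> \<le> 2" for x
    using assms(2)[of x] by linarith
  then have "integrable lborel (\<lambda>x. indicator {a..b} x * (x ^ k * (1 + h x)) / (b - a))"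
    using assms(1) by (intro integrable_divide integrable_indicator_mult_bounded) auto
  then show ?thesis
    by (simp add: mult_ac)
qed

text \<open>Linearity in 1 + h. The case \<open>k = 0\<close> gives the total mass of
  \<open>tilted_uniform\<close>, general \<open>k\<close> its moments.\<close>

lemma LBINT_tilted_density:
  fixes h :: "real \<Rightarrow> real"
  assumes "h \<in> borel_measurable borel" "\<And>x. \<bar>h x\<bar> \<le> 1"
  shows "(LBINT x. indicator {a..b} x * (1 + h x) / (b - a) * x ^ k) =
    ((LBINT x. indicator {a..b} x * x ^ k) + (LBINT x. indicator {a..b} x * (x ^ k * h x))) / (b - a)"
proof -
  have "(LBINT x. indicator {a..b} x * (1 + h x) / (b - a) * x ^ k) =
      (LBINT x. (indicator {a..b} x * (x ^ k * 1) + indicator {a..b} x * (x ^ k * h x)) / (b - a))"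
    by (intro Bochner_Integration.integral_cong) (auto simp: field_simps)
  also have "\<dots> = ((LBINT x. indicator {a..b} x * (x ^ k * 1)) +
      (LBINT x. indicator {a..b} x * (x ^ k * h x))) / (b - a)"
    using integrable_indicator_mult_bounded[of "\<lambda>_. 1" 1 a b k]
      integrable_indicator_mult_bounded[OF assms, of a b k]
    by (simp only: integral_divide_zero) (simp add: Bochner_Integration.integral_add)
  finally show ?thesis
    by simp
qed

lemma moment_tilted_uniform:
  assumes "h \<in> borel_measurable borel" "\<And>x. \<bar>h x\<bar> \<le> 1" "a < b"
  shows "moment (tilted_uniform a b h) k =
    ((LBINT x. indicator {a..b} x * x ^ k) + (LBINT x. indicator {a..b} x * (x ^ k * h x))) / (b - a)"
proof -
  have "1 + h x \<ge> 0" for x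
    using assms(2)[of x] by linarith
  then show ?thesis
    unfolding moment_def tilted_uniform_def LBINT_tilted_density[OF assms(1,2), symmetric]
    using assms by (subst integral_density) auto
qed

lemma tilted_uniform_properties:
  assumes h: "h \<in> borel_measurable borel" "\<And>x. \<bar>h x\<bar> \<le> 1" and ab: "a < b"
    and mean: "(LBINT x. indicator {a..b} x * h x) = 0"
  shows "real_distribution (tilted_uniform a b h)"
    and "absolutely_continuous lborel (tilted_uniform a b h)"
    and "measure_support (tilted_uniform a b h) \<subseteq> {a..b}"
proof -
  let ?f = "\<lambda>x. indicator {a..b} x * (1 + h x) / (b - a)"
  have f_meas: "?f \<in> borel_measurable borel"
    using h(1) by measurable
  have "1 + h x \<ge> 0" for x
    using h(2)[of x] by linarith
  then have f_nonneg: "?f x \<ge> 0" for x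
    using ab by auto
  have "(\<integral>\<^sup>+ x. ennreal (?f x) \<partial>lborel) = ennreal (LBINT x. ?f x)"
    using integrable_tilted_density[OF h, of a b 0] f_nonneg
    by (intro nn_integral_eq_integral) auto
  also have "(LBINT x. ?f x) = 1"
    using LBINT_tilted_density[OF h, of a b 0] mean ab by simp
  finally have "prob_space (tilted_uniform a b h)"
    unfolding tilted_uniform_def using f_meas
    by (intro prob_spaceI) (simp add: emeasure_density)
  then show "real_distribution (tilted_uniform a b h)"
    by (auto simp: real_distribution_def real_distribution_axioms_def tilted_uniform_def)
  show "absolutely_continuous lborel (tilted_uniform a b h)"
    unfolding tilted_uniform_def using f_meas
    by (intro absolutely_continuousI_density) auto
  \<comment> \<open>The complement of the interval is an open null set, so none of its points lies
    in the support.\<close>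
  have "emeasure (tilted_uniform a b h) (- {a..b}) = 0"
    unfolding tilted_uniform_def using f_meas
    by (subst emeasure_density) (auto simp: indicator_def nn_integral_0_iff_AE)
  moreover have "open (- {a..b})"
    by (simp add: open_Compl)
  ultimately show "measure_support (tilted_uniform a b h) \<subseteq> {a..b}"
    unfolding measure_support_def
    by (metis (mono_tags, lifting) Compl_iff less_irrefl mem_Collect_eq subsetI)
qed

section \<open>Positivity when one subinterval dominates\<close>

text \<open>Between \<open>t\<close> and \<open>u\<close> the integrand is x^k, and elsewhere on
  [a, b] it is at least -x^k. Hence the integral is at least twice that of x^k over [t, u] minus
  that over [a, b]; \<open>dom\<close> makes this positive, since a^(k+1) \<ge> 0.\<close>

lemma LBINT_power_mult_pos:
  fixes h :: "real \<Rightarrow> real"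
  assumes h: "h \<in> borel_measurable borel" "\<And>x. \<bar>h x\<bar> \<le> 1"
    and one: "\<And>x. t < x \<Longrightarrow> x < u \<Longrightarrow> h x = 1"
    and order: "0 \<le> a" "a \<le> t" "t \<le> u" "u \<le> b"
    and dom: "b ^ Suc k + 2 * t ^ Suc k < 2 * u ^ Suc k"
  shows "(LBINT x. indicator {a..b} x * (x ^ k * h x)) > 0"
proof -
  have int: "integrable lborel (\<lambda>x. x ^ k * indicator {c..d} x :: real)" for c d
    using integrable_indicator_mult_bounded[of "\<lambda>_. 1" 1 c d k] by (simp add: mult.commute)
  have "0 < (2 * (u ^ Suc k - t ^ Suc k) - (b ^ Suc k - a ^ Suc k)) / Suc k"
    using dom zero_le_power[OF order(1), of "Suc k"]
    by (intro divide_pos_pos) (simp_all del: power_Suc)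
  also have "\<dots> = 2 * (LBINT x. x ^ k * indicator {t..u} x) - (LBINT x. x ^ k * indicator {a..b} x)"
    using order by (simp add: integral_power diff_divide_distrib del: power_Suc)
  also have "\<dots> = (LBINT x. 2 * (x ^ k * indicator {t..u} x) - x ^ k * indicator {a..b} x)"
    using int by simp
  also have "\<dots> \<le> (LBINT x. indicator {a..b} x * (x ^ k * h x))"
  proof (rule integral_mono_AE)
    show "integrable lborel (\<lambda>x. 2 * (x ^ k * indicator {t..u} x) - x ^ k * indicator {a..b} x)"
      using int by simp
    show "integrable lborel (\<lambda>x. indicator {a..b} x * (x ^ k * h x))"
      using h by (rule integrable_indicator_mult_bounded)
    show "AE x in lborel. 2 * (x ^ k * indicator {t..u} x) - x ^ k * indicator {a..b} x
        \<le> indicator {a..b} x * (x ^ k * h x)"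
      \<comment> \<open>The value of \<open>h\<close> at \<open>t\<close> and \<open>u\<close> is
        not prescribed, so these two points are discarded as a null set.\<close>
      using AE_lborel_singleton[of t] AE_lborel_singleton[of u]
    proof eventually_elim
      case (elim x)
      show ?case
      proof (cases "t < x \<and> x < u")
        case True
        then show ?thesis
          using one[of x] order by simp
      next
        case False
        have "x ^ k * (- 1) \<le> x ^ k * h x" if "a \<le> x"
          using that order h(2)[of x] by (intro mult_left_mono) (auto simp: abs_le_iff)
        then show ?thesis
          using False elim order by (auto simp: indicator_def)
      qed
    qed
  qed
  finally show ?thesis .
qed

section \<open>The oscillating function\<close>

text \<open>The last two properties have the same form, for \<open>h\<close> and for
  \<open>- h\<close>, so that one argument proves both.\<close>

lemma exists_oscillating_function:
  fixes a b :: real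
  assumes "0 \<le> a" and "a < b"
  obtains h :: "real \<Rightarrow> real" where
    "h \<in> borel_measurable borel" "\<And>x. \<bar>h x\<bar> \<le> 1"
    "(LBINT x. indicator {a..b} x * h x) = 0"
    "\<exists>\<^sub>\<infinity>k. (LBINT x. indicator {a..b} x * (x ^ k * h x)) > 0"
    "\<exists>\<^sub>\<infinity>k. (LBINT x. indicator {a..b} x * (x ^ k * - h x)) > 0"
proof -
  define t where "t n = b * root (8 ^ n) (1 / 4)" for n :: nat
  define m where "m = (a + b) / 2"
  define A where "A = (\<Union>n. {t (2 * n)<..<t (2 * n + 1)})"
  define s where "s x = (if x \<in> A then 1 else - 1 :: real)" for x
  \<comment> \<open>With this value the integral of \<open>h\<close> over [a, m) cancels that over
    [m, b]. As both halves have equal length and \<open>\<bar>s x\<bar> = 1\<close>, also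
    \<open>\<bar>c\<bar> \<le> 1\<close>.\<close>
  define c where "c = - (LBINT x. indicator {m..b} x * s x) / (m - a)"
  define h where "h x = (if x < m then c else s x)" for x
  have "0 < b" and m: "a < m" "m < b" "m - a = b - m"
    using assms by (auto simp: m_def field_simps)
  have t_mono: "strict_mono t"
  proof (rule strict_monoI)
    fix i j :: nat assume "i < j"
    then have "(8::nat) ^ i < 8 ^ j"
      by (intro power_strict_increasing) auto
    then show "t i < t j"
      unfolding t_def using \<open>0 < b\<close> by (intro mult_strict_left_mono real_root_strict_increasing) auto
  qed
  have "filterlim (\<lambda>n. (8::nat) ^ n) sequentially sequentially"
    by (intro filterlim_subseq) (auto simp: strict_mono_def power_strict_increasing)
  then have "(\<lambda>n. root (8 ^ n) (1 / 4)) \<longlonglongrightarrow> 1"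
    using LIMSEQ_root_const[of "1 / 4"] filterlim_compose[of "\<lambda>n. root n (1 / 4)"] by auto
  then have "t \<longlonglongrightarrow> b * 1"
    unfolding t_def by (intro tendsto_mult tendsto_const)
  \<comment> \<open>From index \<open>N\<close> on, the intervals lie to the right of
    \<open>m\<close>, where \<open>h\<close> agrees with \<open>s\<close>.\<close>
  then have "eventually (\<lambda>n. m < t n) sequentially"
    using m by (auto simp: order_tendsto_iff)
  then obtain N where N: "\<And>n. N \<le> n \<Longrightarrow> m < t n"
    by (auto simp: eventually_sequentially)
  have t_le: "t n \<le> b" for n
    unfolding t_def using \<open>0 < b\<close> by (simp add: mult_le_cancel_left2)
  have s_meas: "s \<in> borel_measurable borel"
    unfolding s_def A_def by measurable
  have s_abs: "\<bar>s x\<bar> \<le> 1" for x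
    by (simp add: s_def)
  have s_int: "integrable lborel (\<lambda>x. indicator {m..b} x * s x)"
    using integrable_indicator_mult_bounded[OF s_meas s_abs, of m b 0] by simp
  have "\<bar>LBINT x. indicator {m..b} x * s x\<bar> \<le> (LBINT x. \<bar>indicator {m..b} x * s x\<bar>)"
    by (rule integral_abs_bound)
  also have "\<dots> = (LBINT x. indicator {m..b} x)"
    by (intro Bochner_Integration.integral_cong) (auto simp: indicator_def s_def)
  also have "\<dots> = m - a"
    using m by simp
  finally have c_abs: "\<bar>c\<bar> \<le> 1"
    unfolding c_def using m by (simp add: divide_le_eq_1)
  have h_meas: "h \<in> borel_measurable borel"
    unfolding h_def using s_meas by measurable
  have h_abs: "\<bar>h x\<bar> \<le> 1" for x
    unfolding h_def using c_abs s_abs by simp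
  have "(LBINT x. indicator {a..b} x * h x) =
      (LBINT x. c * indicator {a..<m} x + indicator {m..b} x * s x)"
    using m by (intro Bochner_Integration.integral_cong) (auto simp: h_def indicator_def)
  also have "\<dots> = c * (m - a) + (LBINT x. indicator {m..b} x * s x)"
    using s_int m by (subst Bochner_Integration.integral_add) auto
  also have "\<dots> = 0"
    using m by (simp add: c_def)
  finally have h_mean: "(LBINT x. indicator {a..b} x * h x) = 0" .
  have h_even: "h x = 1" if "t (2 * n) < x" "x < t (2 * n + 1)" "N \<le> n" for n x
    using that N[of "2 * n"] by (auto simp: h_def s_def A_def)
  have h_odd: "- h x = 1" if "t (2 * n + 1) < x" "x < t (2 * n + 2)" "N \<le> n" for n x
  proof -
    have "x \<notin> A"
    proof
      assume "x \<in> A"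
      then obtain j where "t (2 * j) < x" "x < t (2 * j + 1)"
        by (auto simp: A_def)
      with that have "t (2 * j) < t (2 * n + 2)" "t (2 * n + 1) < t (2 * j + 1)"
        by linarith+
      \<comment> \<open>An overlap of the two intervals would force both \<open>j \<le> n\<close>
        and \<open>n < j\<close>.\<close>
      then have "2 * j < 2 * n + 2" "2 * n + 1 < 2 * j + 1"
        using strict_mono_less[OF t_mono] by blast+
      then show False
        by presburger
    qed
    then show ?thesis
      using that N[of "2 * n + 1"] by (simp add: h_def s_def)
  qed
  \<comment> \<open>Divided by b^(8^n), the claim reads 1 + 2/4 < 2 v with v the eighth root of 1/4.
    The ratio 8 of successive root orders suffices because (3/4)^8 < 1/4.\<close>
  have dom: "b ^ 8 ^ n + 2 * t n ^ 8 ^ n < 2 * t (Suc n) ^ 8 ^ n" for n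
  proof -
    define v where "v = root 8 (1 / 4 :: real)"
    have "(3 / 4 :: real) = root 8 ((3 / 4) ^ 8)"
      by (intro real_root_power_cancel[symmetric]) auto
    also have "\<dots> < v"
      unfolding v_def by (intro real_root_less_mono) (auto simp: power_divide)
    finally have v: "3 / 4 < v" .
    have "root (8 ^ n) (1 / 4) ^ 8 ^ n = (1 / 4 :: real)"
      by (intro real_root_pow_pos2) auto
    moreover have "root (8 ^ Suc n) (1 / 4) ^ 8 ^ n = v"
      unfolding v_def by (simp add: real_root_mult_exp mult.commute[of 8] real_root_pow_pos2)
    ultimately have "4 * t n ^ 8 ^ n = b ^ 8 ^ n" "t (Suc n) ^ 8 ^ n = b ^ 8 ^ n * v"
      by (simp_all add: t_def power_mult_distrib)
    then show ?thesis
      using mult_strict_left_mono[OF v zero_less_power[OF \<open>0 < b\<close>, of "8 ^ n"]] by linarith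
  qed
  \<comment> \<open>The parity \<open>i\<close> selects the intervals on which \<open>g\<close> is
    1: even ones for \<open>h\<close>, odd ones for \<open>- h\<close>.\<close>
  have infinitely_often: "\<exists>\<^sub>\<infinity>k. (LBINT x. indicator {a..b} x * (x ^ k * g x)) > 0"
    if g: "g \<in> borel_measurable borel" "\<And>x. \<bar>g x\<bar> \<le> 1"
      and one: "\<And>n x. N \<le> n \<Longrightarrow> t (2 * n + i) < x \<Longrightarrow> x < t (2 * n + i + 1) \<Longrightarrow> g x = 1"
    for g :: "real \<Rightarrow> real" and i :: nat
    unfolding INFM_nat_le
  proof
    fix l
    \<comment> \<open>The summand \<open>N\<close> puts the interval to the right of
      \<open>m\<close>, and \<open>l\<close> ensures \<open>l \<le> j \<le> k\<close>. Integrating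
      x^k raises the exponent by one, so \<open>Suc k\<close>, not \<open>k\<close>, is the power of
      8.\<close>
    define j where "j = 2 * (N + l) + i"
    define k where "k = (8::nat) ^ j - 1"
    have k: "Suc k = 8 ^ j"
      by (simp add: k_def)
    have "j < 8 ^ j"
      by (rule less_exp[THEN less_le_trans]) (simp add: power_mono)
    then have "l \<le> k"
      using k by (simp add: j_def)
    moreover have "(LBINT x. indicator {a..b} x * (x ^ k * g x)) > 0"
    proof (rule LBINT_power_mult_pos[OF g])
      show "g x = 1" if "t j < x" "x < t (Suc j)" for x
        using one[of "N + l" x] that by (simp add: j_def)
      show "a \<le> t j"
        using N[of j] m by (simp add: j_def)
      show "t j \<le> t (Suc j)"
        using t_mono by (simp add: strict_mono_less_eq)
      show "b ^ Suc k + 2 * t j ^ Suc k < 2 * t (Suc j) ^ Suc k"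
        unfolding k by (rule dom)
    qed (use assms t_le in auto)
    ultimately show "\<exists>k\<ge>l. (LBINT x. indicator {a..b} x * (x ^ k * g x)) > 0"
      by blast
  qed
  show thesis
  proof (rule that[OF h_meas h_abs h_mean])
    show "\<exists>\<^sub>\<infinity>k. (LBINT x. indicator {a..b} x * (x ^ k * h x)) > 0"
      using h_meas h_abs h_even by (intro infinitely_often[where i = 0]) auto
    show "\<exists>\<^sub>\<infinity>k. (LBINT x. indicator {a..b} x * (x ^ k * - h x)) > 0"
      using h_meas h_abs h_odd by (intro infinitely_often[where i = 1]) auto
  qed
qed

section \<open>Incomparability in the tail order\<close>

text \<open>A single strict inequality already excludes \<open>P = Q\<close>; infinitely many
  contradict the inequality for almost all \<open>k\<close>.\<close>

lemma not_tail_le_if_moment_less: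
  assumes "\<exists>\<^sub>\<infinity>k. moment Q k < moment P k"
  shows "\<not> P \<preceq>tail Q"
  using assms unfolding tail_le_def by (auto simp: not_MOST not_le)

theorem mainTheorem6:
  fixes a b :: real
  assumes "0 \<le> a" and "a < b"
  shows "\<exists>P\<^sub>x P\<^sub>y :: real measure.
           real_distribution P\<^sub>x \<and> real_distribution P\<^sub>y \<and>
           absolutely_continuous lborel P\<^sub>x \<and> absolutely_continuous lborel P\<^sub>y \<and>
           measure_support P\<^sub>x \<subseteq> {a..b} \<and> measure_support P\<^sub>y \<subseteq> {a..b} \<and>
           \<not> P\<^sub>x \<preceq>tail P\<^sub>y \<and> \<not> P\<^sub>y \<preceq>tail P\<^sub>x"
proof -
  obtain h :: "real \<Rightarrow> real" where
    h: "h \<in> borel_measurable borel" "\<And>x. \<bar>h x\<bar> \<le> 1" and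
    mean: "(LBINT x. indicator {a..b} x * h x) = 0" and
    pos: "\<exists>\<^sub>\<infinity>k. (LBINT x. indicator {a..b} x * (x ^ k * h x)) > 0" and
    neg: "\<exists>\<^sub>\<infinity>k. (LBINT x. indicator {a..b} x * (x ^ k * - h x)) > 0"
    by (rule exists_oscillating_function[OF assms]) (rule that)
  let ?P = "tilted_uniform a b h" and ?Q = "tilted_uniform a b (\<lambda>x. - h x)"
  have h': "(\<lambda>x. - h x) \<in> borel_measurable borel" "\<And>x. \<bar>- h x\<bar> \<le> 1"
    using h by auto
  have mean': "(LBINT x. indicator {a..b} x * - h x) = 0"
    using mean by simp
  \<comment> \<open>The uniform parts of the two moments cancel, leaving 2 / (b - a) times the
    integral of x^k h.\<close>
  have less_iff: "moment ?Q k < moment ?P k \<longleftrightarrow> (LBINT x. indicator {a..b} x * (x ^ k * h x)) > 0"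
    "moment ?P k < moment ?Q k \<longleftrightarrow> (LBINT x. indicator {a..b} x * (x ^ k * - h x)) > 0" for k
    using assms by (auto simp: moment_tilted_uniform[OF h] moment_tilted_uniform[OF h']
      divide_less_cancel)
  have "\<not> ?P \<preceq>tail ?Q" "\<not> ?Q \<preceq>tail ?P"
    using pos neg by (intro not_tail_le_if_moment_less; simp only: less_iff)+
  then show ?thesis
    using tilted_uniform_properties[OF h assms(2) mean]
      tilted_uniform_properties[OF h' assms(2) mean'] by blast
qed

end
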